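(* Let $G$ be the infinite hexagonal grid and let a fire start at a single vertex $f$ of $G$ (so $F^{(1)}=\{f\}$). For every positive integer $\tau$, there is a strategy for the firefighters that protects at most one vertex on every even turn other than turn $2\tau$, and at most two vertices on turn $2\tau$, and that contains the fire.
   Context: The infinite hexagonal grid is the graph whose vertices and edges are the vertices and edges of the tiling of the plane by regular hexagons. Firefighter process on a graph with vertex set $V$: $F^{(t)}$ is the set of vertices on fire at turn $t$ and $P^{(t)}$ the set of protected vertices at turn $t$. On turn $1$, $F^{(1)}$ is a given non-empty subset of $V$ (the initial fire) and $P^{(1)}=\varnothing$. On an even turn $2t$, the firefighters choose a subset of $V\setminus F^{(2t-1)}$ to protect; $P^{(2t)}$ is the union of $P^{(2t-1)}$ and this subset, and $F^{(2t)}=F^{(2t-1)}$. On an odd turn $2t+1$ with $t\ge 1$, $F^{(2t+1)}=N[F^{(2t)}]\setminus P^{(2t)}$, where $N[\cdot]$ is the closed neighborhood, and $P^{(2t+1)}=P^{(2t)}$. On turn $t$, a vertex is saved if it is in $P^{(t)}$ or lies in a component of the subgraph induced by $V\setminus P^{(t)}$ that contains no burning vertex. The fire is contained if at some turn all but finitely many vertices are saved. *)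

theory Defs
  imports Complex_Main
begin

text \<open>A graph is given by a vertex set \<open>V\<close> and a set \<open>E\<close> of edges, each edge being the
  two-element set of its ends.\<close>

text \<open>The tiling is placed in the complex plane so that all hexagons have side length 1 and one
  of them has corners the sixth roots of unity. The hexagon on the other side of its edge between
  \<open>1\<close> and \<open>cis (pi/3)\<close> is centred at \<open>1 + cis (pi/3)\<close>; this vector and its rotation by \<open>pi/3\<close>
  generate the lattice of all centres.\<close>

definition hex_centres :: "complex set" where
  "hex_centres =
     {(of_int a + of_int b * cis (pi / 3)) * (1 + cis (pi / 3)) | a b :: int. True}"

definition hex_corner :: "complex \<Rightarrow> nat \<Rightarrow> complex" where
  "hex_corner c k = c + cis (real k * pi / 3)"

definition hex_vertices :: "complex set" where
  "hex_vertices = {hex_corner c k | c k. c \<in> hex_centres}"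

definition hex_edges :: "complex set set" where
  "hex_edges = {{hex_corner c k, hex_corner c (Suc k)} | c k. c \<in> hex_centres}"

definition closed_nbhd :: "'a set \<Rightarrow> 'a set set \<Rightarrow> 'a set \<Rightarrow> 'a set" where
  "closed_nbhd V E S = S \<union> {v \<in> V. \<exists>u\<in>S. {u, v} \<in> E}"

definition connected_within :: "'a set set \<Rightarrow> 'a set \<Rightarrow> 'a \<Rightarrow> 'a \<Rightarrow> bool" where
  "connected_within E W = (\<lambda>x y. x \<in> W \<and> y \<in> W \<and> {x, y} \<in> E)\<^sup>*\<^sup>*"

text \<open>The vertex sets of the components of the subgraph induced by \<open>W\<close>.\<close>

definition induced_components :: "'a set set \<Rightarrow> 'a set \<Rightarrow> 'a set set" where
  "induced_components E W = {{v \<in> W. connected_within E W u v} | u. u \<in> W}"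

text \<open>\<open>F t\<close>, \<open>P t\<close> are the burning and protected vertices at turn \<open>t\<close>, and for even \<open>t\<close>
  the set \<open>D t\<close> is what the firefighters choose to protect on that turn, so that \<open>D\<close> is their
  strategy. Turns are counted from 1; the values of \<open>F\<close> and \<open>P\<close> at 0 and of \<open>D\<close> at 0 and at odd
  turns are irrelevant.\<close>

definition firefighter_process ::
  "'a set \<Rightarrow> 'a set set \<Rightarrow> 'a set \<Rightarrow> (nat \<Rightarrow> 'a set) \<Rightarrow> (nat \<Rightarrow> 'a set) \<Rightarrow> (nat \<Rightarrow> 'a set) \<Rightarrow> bool" where
  "firefighter_process V E F0 D F P \<longleftrightarrow>
     F0 \<noteq> {} \<and> F0 \<subseteq> V \<and> F 1 = F0 \<and> P 1 = {} \<and>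
     (\<forall>t\<ge>1.
        D (2 * t) \<subseteq> V - F (2 * t - 1) \<and>
        P (2 * t) = P (2 * t - 1) \<union> D (2 * t) \<and>
        F (2 * t) = F (2 * t - 1) \<and>
        F (2 * t + 1) = closed_nbhd V E (F (2 * t)) - P (2 * t) \<and>
        P (2 * t + 1) = P (2 * t))"

definition saved_at ::
  "'a set \<Rightarrow> 'a set set \<Rightarrow> (nat \<Rightarrow> 'a set) \<Rightarrow> (nat \<Rightarrow> 'a set) \<Rightarrow> nat \<Rightarrow> 'a \<Rightarrow> bool" where
  "saved_at V E F P t v \<longleftrightarrow>
     v \<in> P t \<or> (\<exists>C \<in> induced_components E (V - P t). v \<in> C \<and> C \<inter> F t = {})"

definition fire_contained ::
  "'a set \<Rightarrow> 'a set set \<Rightarrow> (nat \<Rightarrow> 'a set) \<Rightarrow> (nat \<Rightarrow> 'a set) \<Rightarrow> bool" where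
  "fire_contained V E F P \<longleftrightarrow> (\<exists>t\<ge>1. finite {v \<in> V. \<not> saved_at V E F P t v})"

end

theory Submission
  imports Defs
begin

text \<open>
  Give every vertex of the grid integer coordinates \<open>(a, b, c)\<close> with sum \<open>0\<close> or \<open>1\<close>, so that an
  edge changes one coordinate by \<open>1\<close>. Distances in the grid are then distances in the
  \<open>l\<^sub>1\<close>-norm, and the starting point of the fire may be taken to be the origin. A straight wall is
  a sequence of vertices at mutual distance \<open>2\<close> such as \<open>(1, - i, i)\<close>. So a wall with only one growing
  end outruns the fire by a factor of two, whereas a wall that grows at both ends just keeps up with
  the fire.

  First, one vertex per turn keeps the fire in the wedge \<open>a \<le> 0\<close>, \<open>c \<ge> 0\<close> of angle \<open>2 pi / 3\<close>: its
  boundary vertices are reached at times \<open>1, 2, 3, \<dots>\<close>, one at a time, so that nothing is ever to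
  spare, and this can go on until the extra firefighter has come. Bending both walls of
  the wedge by \<open>pi / 3\<close>, so that they become parallel and leave a strip \<open>- r \<le> b \<le> r\<close>, puts
  the firefighters behind by exactly one vertex, which is what the extra firefighter makes up for; keeping
  the fire in the strip costs nothing further. When the strip is long compared with its width, the
  wall at \<open>b = r + 1\<close> is abandoned, and all firefighters work at the end of the other wall. They extend
  it by five straight pieces that lead around the end of the abandoned wall and back to its rear side.
  The detour that each piece needs for the next one to be finished in time is a constant multiple of
  the width, so that a strip of length \<open>12 r\<close> suffices. In the end the fire is confined to a
  hexagon with the abandoned wall as a slit.

  The process itself need not be followed. It suffices to know a finite set that the fire does not leave, the
  order in which its boundary is protected, and a lower bound, changing by at most \<open>1\<close> along edges, for the time at which
  the fire arrives (lemma \<open>containment_by_potential\<close>). All three are given by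
  piecewise linear formulas in the coordinates, and the hypotheses on them are linear arithmetic
  (lemmas \<open>potential_lipschitz\<close>, \<open>barrier_cases\<close>, \<open>inj_on_slot\<close>). Lemma \<open>hex_coordinates\<close> carries
  the result over to the tiling.
\<close>

section \<open>A static certificate of containment\<close>

text \<open>The fire never gets out of \<open>K\<close> if each boundary vertex \<open>b\<close> is protected by turn \<open>2 * d b\<close>,
  since the fire reaches a vertex \<open>v\<close> no earlier than on turn \<open>2 * d v + 1\<close>. The vertices are
  protected in the order of their slots. The additional one on turn \<open>2 * \<tau>\<close> puts the
  firefighters one turn ahead of the slots from then on, which is why \<open>slot b \<le> d b\<close> is asked for only up to
  slot \<open>\<tau>\<close>.\<close>

lemma containment_by_potential:
  fixes V :: "'a set" and E :: "'a set set" and d slot :: "'a \<Rightarrow> int" and \<tau> :: nat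
  assumes f: "f \<in> K" "d f = 0"
    and K: "K \<subseteq> V" "finite K"
    and B: "B \<subseteq> V" "finite B" "K \<inter> B = {}"
    and closed: "\<And>u v. u \<in> K \<Longrightarrow> v \<in> V \<Longrightarrow> {u, v} \<in> E \<Longrightarrow> v \<in> K \<union> B"
    and lipschitz: "\<And>u v. u \<in> K \<Longrightarrow> v \<in> V \<Longrightarrow> {u, v} \<in> E \<Longrightarrow> d v \<le> d u + 1"
    and slot: "inj_on slot B" "\<And>b. b \<in> B \<Longrightarrow> 1 \<le> slot b"
    and early: "\<And>b. b \<in> B \<Longrightarrow> slot b \<le> int \<tau> \<Longrightarrow> slot b \<le> d b"
    and late: "\<And>b. b \<in> B \<Longrightarrow> slot b \<le> d b + 1"
    and \<tau>: "\<tau> \<ge> 1"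
  shows "\<exists>D F P. firefighter_process V E {f} D F P \<and>
           (\<forall>t\<ge>1. t \<noteq> \<tau> \<longrightarrow> finite (D (2 * t)) \<and> card (D (2 * t)) \<le> 1) \<and>
           finite (D (2 * \<tau>)) \<and> card (D (2 * \<tau>)) \<le> 2 \<and>
           fire_contained V E F P"
proof -
  define due where "due b = (if slot b \<le> int \<tau> then slot b else slot b - 1)" for b
  define D where "D t = {b \<in> B. 2 * due b = int t}" for t :: nat
  define prot where "prot m = {b \<in> B. due b \<le> int m}" for m :: nat
  define fire where
    "fire = rec_nat {f} (\<lambda>m S. closed_nbhd V E S - prot (Suc m))"
  define F where "F t = fire ((t - 1) div 2)" for t :: nat
  define P where "P t = prot (t div 2)" for t :: nat
  have fire_simps: "fire 0 = {f}"
    "fire (Suc m) = closed_nbhd V E (fire m) - prot (Suc m)" for m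
    by (simp_all add: fire_def)
  have due_pos: "1 \<le> due b" and due_le: "due b \<le> d b" if "b \<in> B" for b
    using slot(2)[OF that] early[OF that] late[OF that] \<tau> by (auto simp: due_def)
  (* The fire is confined and delayed at once: a vertex outside K that it would reach next lies in B,
     and its potential shows that it has been protected by then. *)
  have fire_bound: "fire m \<subseteq> {v \<in> K. d v \<le> int m}" for m
  proof (induction m)
    case 0
    then show ?case using f by (simp add: fire_simps)
  next
    case (Suc m)
    show ?case
    proof
      fix v assume v: "v \<in> fire (Suc m)"
      then have notp: "v \<notin> prot (Suc m)" by (simp add: fire_simps)
      from v consider "v \<in> fire m" | u where "u \<in> fire m" "v \<in> V" "{u, v} \<in> E"
        by (auto simp: fire_simps closed_nbhd_def)
      then show "v \<in> {v \<in> K. d v \<le> int (Suc m)}"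
      proof cases
        case 1
        then show ?thesis using Suc by auto
      next
        case 2
        then have u: "u \<in> K" "d u \<le> int m" using Suc by auto
        then have dv: "d v \<le> int (Suc m)" using lipschitz[OF u(1) 2(2,3)] by simp
        have "v \<notin> B"
          using notp due_le[of v] dv by (auto simp: prot_def)
        then show ?thesis using closed[OF u(1) 2(2,3)] dv by auto
      qed
    qed
  qed
  then have F_K: "F t \<subseteq> K" for t by (auto simp: F_def)
  have process: "firefighter_process V E {f} D F P"
    unfolding firefighter_process_def
  proof (intro conjI allI impI)
    show "{f} \<noteq> {}" "{f} \<subseteq> V" using f K by auto
    show "F 1 = {f}" by (simp add: F_def fire_simps)
    show "P 1 = {}" using due_pos by (force simp: P_def prot_def)
    fix t :: nat assume t: "1 \<le> t"
    then obtain m where m: "t = Suc m" by (cases t) auto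
    show "D (2 * t) \<subseteq> V - F (2 * t - 1)" using F_K B by (auto simp: D_def)
    have [simp]: "(2 * t - 1) div 2 = m" using m by simp
    have "prot (Suc m) = prot m \<union> D (2 * t)"
      using m by (auto simp: prot_def D_def)
    then show "P (2 * t) = P (2 * t - 1) \<union> D (2 * t)"
      using m by (simp add: P_def)
    show "F (2 * t) = F (2 * t - 1)"
      using m by (simp add: F_def)
    show "F (2 * t + 1) = closed_nbhd V E (F (2 * t)) - P (2 * t)"
      using m by (simp add: F_def P_def fire_simps)
    show "P (2 * t + 1) = P (2 * t)" by (simp add: P_def)
  qed
  have fin: "finite (D t)" for t
    using B(2) by (simp add: D_def)
  have one: "card (D (2 * t)) \<le> 1" if "t \<noteq> \<tau>" for t
  proof -
    have "x = y" if "x \<in> D (2 * t)" "y \<in> D (2 * t)" for x y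
    proof (rule inj_onD[OF slot(1)])
      show "slot x = slot y"
        using that \<open>t \<noteq> \<tau>\<close> by (auto simp: D_def due_def split: if_splits)
    qed (use that in \<open>auto simp: D_def\<close>)
    then show ?thesis using fin by (simp add: card_le_Suc0_iff_eq)
  qed
  have two: "card (D (2 * \<tau>)) \<le> 2"
  proof -
    have "slot ` D (2 * \<tau>) \<subseteq> {int \<tau>, int \<tau> + 1}"
      by (auto simp: D_def due_def split: if_splits)
    then have "card (slot ` D (2 * \<tau>)) \<le> card {int \<tau>, int \<tau> + 1}"
      by (intro card_mono) auto
    moreover have "inj_on slot (D (2 * \<tau>))"
      by (rule inj_on_subset[OF slot(1)]) (auto simp: D_def)
    ultimately show ?thesis by (simp add: card_image)
  qed
  have contained: "fire_contained V E F P"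
  proof -
    define m where "m = nat (Max (insert 0 (due ` B)))"
    have "due b \<le> int (Suc m)" if "b \<in> B" for b
    proof -
      have "due b \<le> Max (insert 0 (due ` B))"
        using that B(2) by (intro Max_ge) auto
      then show ?thesis by (simp add: m_def)
    qed
    then have P_B: "P (2 * Suc m) = B"
      by (auto simp: P_def prot_def)
    have "saved_at V E F P (2 * Suc m) v" if v: "v \<in> V" "v \<notin> K" for v
    proof (cases "v \<in> B")
      case True
      then show ?thesis unfolding saved_at_def P_B by blast
    next
      case False
      define C where "C = {x \<in> V - B. connected_within E (V - B) v x}"
      have "x \<notin> K" if "connected_within E (V - B) v x" for x
        using that unfolding connected_within_def
      proof (induction rule: rtranclp_induct)
        case base
        then show ?case using v by simp
      next
        case (step y z)
        then show ?case
          using closed[of z y] by (auto simp: insert_commute)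
      qed
      then have "C \<inter> F (2 * Suc m) = {}"
        using F_K by (auto simp: C_def)
      moreover have "v \<in> C"
        using v False by (simp add: C_def connected_within_def)
      moreover have "C \<in> induced_components E (V - B)"
        unfolding induced_components_def C_def using v False by auto
      ultimately show ?thesis unfolding saved_at_def P_B by blast
    qed
    then have "{v \<in> V. \<not> saved_at V E F P (2 * Suc m) v} \<subseteq> K" by auto
    then have "finite {v \<in> V. \<not> saved_at V E F P (2 * Suc m) v}"
      using K(2) by (rule finite_subset)
    then show ?thesis unfolding fire_contained_def
      by (intro exI[of _ "2 * Suc m"]) simp
  qed
  show ?thesis
    by (intro exI[of _ D] exI[of _ F] exI[of _ P] conjI allI impI process fin one two contained)
qed

section \<open>The burnt region and its boundary\<close>

text \<open>Adding the same integer to all three coordinates will not change the point of the plane that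
  they describe (with a vertex as the origin), so a point is determined by the residue of the sum modulo \<open>3\<close> and two differences.
  The residue \<open>2\<close> belongs to the centres of the hexagons.\<close>

definition verts :: "(int \<times> int \<times> int) set" where
  "verts = {(a, b, c). a + b + c = 0 \<or> a + b + c = 1}"

definition adj :: "int \<times> int \<times> int \<Rightarrow> int \<times> int \<times> int \<Rightarrow> bool" where
  "adj = (\<lambda>(a, b, c) (a', b', c').
     (\<bar>a - a'\<bar>, \<bar>b - b'\<bar>, \<bar>c - c'\<bar>) \<in> {(1, 0, 0), (0, 1, 0), (0, 0, 1)})"

lemma adj_cases:
  assumes "(a, b, c) \<in> verts" "(a', b', c') \<in> verts" "adj (a, b, c) (a', b', c')"
  obtains
      (up_a) "a' = a + 1" "b' = b" "c' = c" "a + b + c = 0"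
    | (up_b) "a' = a" "b' = b + 1" "c' = c" "a + b + c = 0"
    | (up_c) "a' = a" "b' = b" "c' = c + 1" "a + b + c = 0"
    | (down_a) "a' = a - 1" "b' = b" "c' = c" "a + b + c = 1"
    | (down_b) "a' = a" "b' = b - 1" "c' = c" "a + b + c = 1"
    | (down_c) "a' = a" "b' = b" "c' = c - 1" "a + b + c = 1"
proof -
  have sums: "a + b + c = 0 \<or> a + b + c = 1" "a' + b' + c' = 0 \<or> a' + b' + c' = 1"
    using assms(1,2) by (simp_all add: verts_def)
  from assms(3) consider "\<bar>a - a'\<bar> = 1" "b' = b" "c' = c" | "a' = a" "\<bar>b - b'\<bar> = 1" "c' = c"
    | "a' = a" "b' = b" "\<bar>c - c'\<bar> = 1"
    by (simp add: adj_def) linarith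
  then show thesis
  proof cases
    case 1
    then show thesis using sums up_a down_a by linarith
  next
    case 2
    then show thesis using sums up_b down_b by linarith
  next
    case 3
    then show thesis using sums up_c down_c by linarith
  qed
qed

definition inner_wall :: "int \<Rightarrow> (int \<times> int \<times> int) set" where
  "inner_wall r = {(a, b, c). b = r + 1 \<and> a + b + c = 1 \<and> 0 \<le> c \<and> c \<le> 12 * r}"

text \<open>A hexagon with a slit. The strip \<open>- r \<le> b \<le> r\<close> runs from the origin in the direction
  \<open>(-1, 0, 1)\<close>; the slit is its wall at \<open>b = r + 1\<close>, up to \<open>c = L\<close> where \<open>L = 12 * r\<close>, and the fire gets
  to larger values of \<open>b\<close> only around the end of the slit. The bounds are \<open>C = L + 2 * r + 1\<close> for \<open>c\<close>,
  \<open>A = C + 2 * r\<close> for \<open>- a\<close> and \<open>M = 7 * r + 1\<close> for \<open>b\<close>. Each is what makes one straight piece of the outer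
  wall come in time: \<open>C\<close> the piece that it bounds, \<open>A\<close> and \<open>M\<close> theirs, given the earlier ones, and
  \<open>L \<ge> 12 * r - 1\<close> the last piece, which runs along \<open>c = - 1\<close> to the foot of the slit.\<close>

definition burnt :: "int \<Rightarrow> (int \<times> int \<times> int) set" where
  "burnt r = {(a, b, c) \<in> verts. - (16 * r + 1) \<le> a \<and> a \<le> 0 \<and> - r \<le> b \<and> b \<le> 7 * r + 1 \<and>
                 0 \<le> c \<and> c \<le> 14 * r + 1} - inner_wall r"

definition barrier :: "int \<Rightarrow> (int \<times> int \<times> int) set" where
  "barrier r = {q \<in> verts - burnt r. \<exists>p \<in> burnt r. adj p q}"

text \<open>In front of the slit this is the distance from the origin. Behind it, the fire has to come
  around the end of the slit, and the distance is bounded by two further linear forms, which change by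
  at most \<open>1\<close> along edges because their coefficients are \<open>\<plusminus>1\<close>. Their constant terms are the largest for which neither exceeds the norm on the
  passage \<open>b = r + 1\<close>, \<open>c > 12 * r\<close>: all three agree at \<open>(- 13 * r - 1, r + 1, 12 * r + 1)\<close>.\<close>

definition potential :: "int \<Rightarrow> int \<times> int \<times> int \<Rightarrow> int" where
  "potential r = (\<lambda>(a, b, c).
     if b \<le> r \<or> (a, b, c) \<in> inner_wall r then \<bar>a\<bar> + \<bar>b\<bar> + \<bar>c\<bar>
     else max (\<bar>a\<bar> + \<bar>b\<bar> + \<bar>c\<bar>) (max (b - a - c + 24 * r + 2) (a + b - c + 50 * r + 4)))"

text \<open>The number of a boundary vertex in the order of protection. Up to \<open>26 * r + 2\<close> the two ends of
  the wall alternate: odd slots belong to the end that will be the outer one, even slots to the end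
  that becomes the slit. After that, only the outer end grows, first straight on and then around the
  hexagon.\<close>

definition slot :: "int \<Rightarrow> int \<times> int \<times> int \<Rightarrow> int" where
  "slot r = (\<lambda>(a, b, c).
     if a = 1 then 2 * c + 1
     else if (a, b, c) \<in> inner_wall r then 2 * c + 2 * r + 2
     else if c = -1 then (if b \<le> r then 2 * b else 51 * r + 8 - b)
     else if b = - r - 1 then (if c \<le> 13 * r then 2 * c + 1 else 13 * r + 2 + c)
     else if b = 7 * r + 2 then 44 * r + 6 - c
     else 28 * r + 4 + b)"

text \<open>The boundary consists of nine straight pieces, listed in the order in which they are begun, and on each
  of them the slot is at most one more than the potential. On the first two, the walls of the wedge, the two
  are equal; these are the slots up to \<open>2 * r + 1\<close>, so the extra firefighter may come at any of them.\<close>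

lemma barrier_cases:
  assumes "(a, b, c) \<in> barrier r" "1 \<le> r"
  obtains
    (right) "a = 1" "b = - c" "0 \<le> c" "c \<le> r" "slot r (a, b, c) = 2 * c + 1"
      "potential r (a, b, c) = 2 * c + 1"
  | (left) "c = -1" "a = 1 - b" "1 \<le> b" "b \<le> r" "slot r (a, b, c) = 2 * b"
      "potential r (a, b, c) = 2 * b"
  | (inner) "b = r + 1" "a = - c - r" "0 \<le> c" "c \<le> 12 * r" "slot r (a, b, c) = 2 * c + 2 * r + 2"
      "potential r (a, b, c) = 2 * c + 2 * r + 1"
  | (outer) "b = - r - 1" "a = r + 1 - c" "r + 1 \<le> c" "c \<le> 13 * r"
      "slot r (a, b, c) = 2 * c + 1" "potential r (a, b, c) = 2 * c"
  | (outer_fast) "b = - r - 1" "a = r + 1 - c" "13 * r < c" "c \<le> 14 * r + 1"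
      "slot r (a, b, c) = 13 * r + 2 + c" "potential r (a, b, c) = 2 * c"
  | (far_c) "c = 14 * r + 2" "a = - 14 * r - 1 - b" "- r \<le> b" "b \<le> 2 * r"
      "slot r (a, b, c) = 28 * r + 4 + b" "28 * r + 3 + b \<le> potential r (a, b, c)"
  | (far_a) "a = - 16 * r - 2" "c = 16 * r + 2 - b" "2 * r < b" "b \<le> 7 * r + 1"
      "slot r (a, b, c) = 28 * r + 4 + b" "28 * r + 3 + b \<le> potential r (a, b, c)"
  | (far_b) "b = 7 * r + 2" "a = - 7 * r - 1 - c" "0 \<le> c" "c \<le> 9 * r"
      "slot r (a, b, c) = 44 * r + 6 - c" "44 * r + 5 - c \<le> potential r (a, b, c)"
  | (last) "c = - 1" "a = 1 - b" "r + 2 \<le> b" "b \<le> 7 * r + 1"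
      "slot r (a, b, c) = 51 * r + 8 - b" "51 * r + 7 - b \<le> potential r (a, b, c)"
proof -
  from assms(1) obtain a' b' c' where p: "(a', b', c') \<in> burnt r"
    and q: "(a, b, c) \<in> verts" "(a, b, c) \<notin> burnt r" and adj: "adj (a', b', c') (a, b, c)"
    by (auto simp: barrier_def)
  have p_verts: "(a', b', c') \<in> verts" using p by (simp add: burnt_def)
  from p_verts q(1) adj have "(a, b, c) \<in> inner_wall r \<or>
      a = 1 \<and> a + b + c = 1 \<and> 0 \<le> c \<and> c \<le> r \<or>
      c = -1 \<and> a + b + c = 0 \<and> 1 \<le> b \<and> b \<le> r \<or>
      b = - r - 1 \<and> a + b + c = 0 \<and> r + 1 \<le> c \<and> c \<le> 14 * r + 1 \<or>
      c = 14 * r + 2 \<and> a + b + c = 1 \<and> - r \<le> b \<and> b \<le> 2 * r \<or>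
      a = - 16 * r - 2 \<and> a + b + c = 0 \<and> 2 * r < b \<and> b \<le> 7 * r + 1 \<or>
      b = 7 * r + 2 \<and> a + b + c = 1 \<and> 0 \<le> c \<and> c \<le> 9 * r \<or>
      c = -1 \<and> a + b + c = 0 \<and> r + 2 \<le> b \<and> b \<le> 7 * r + 1"
  proof (cases rule: adj_cases)
    case up_a
    then show ?thesis using p q \<open>1 \<le> r\<close>
      by (simp add: burnt_def verts_def inner_wall_def) (smt (verit))
  next
    case up_b
    then show ?thesis using p q \<open>1 \<le> r\<close>
      by (simp add: burnt_def verts_def inner_wall_def) (smt (verit))
  next
    case up_c
    then show ?thesis using p q \<open>1 \<le> r\<close>
      by (simp add: burnt_def verts_def inner_wall_def) (smt (verit))
  next
    case down_a
    then show ?thesis using p q \<open>1 \<le> r\<close>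
      by (simp add: burnt_def verts_def inner_wall_def)
  next
    case down_b
    then show ?thesis using p q \<open>1 \<le> r\<close>
      by (simp add: burnt_def verts_def inner_wall_def)
  next
    case down_c
    then show ?thesis using p q \<open>1 \<le> r\<close>
      by (simp add: burnt_def verts_def inner_wall_def) (smt (verit))
  qed
  then show thesis
  proof (elim disjE conjE)
    assume w: "(a, b, c) \<in> inner_wall r"
    then show thesis
      using \<open>1 \<le> r\<close> by (intro inner) (auto simp: slot_def potential_def inner_wall_def)
  next
    assume "a = 1" "a + b + c = 1" "0 \<le> c" "c \<le> r"
    then show thesis
      using \<open>1 \<le> r\<close> by (intro right) (auto simp: slot_def potential_def inner_wall_def)
  next
    assume "c = -1" "a + b + c = 0" "1 \<le> b" "b \<le> r"
    then show thesis
      using \<open>1 \<le> r\<close> by (intro left) (auto simp: slot_def potential_def inner_wall_def)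
  next
    assume "b = - r - 1" "a + b + c = 0" "r + 1 \<le> c" "c \<le> 14 * r + 1"
    then show thesis
      using \<open>1 \<le> r\<close> by (cases "c \<le> 13 * r", intro outer)
       (auto intro!: outer_fast simp: slot_def potential_def inner_wall_def)
  next
    assume "c = 14 * r + 2" "a + b + c = 1" "- r \<le> b" "b \<le> 2 * r"
    then show thesis
      using \<open>1 \<le> r\<close> by (intro far_c) (auto simp: slot_def potential_def inner_wall_def)
  next
    assume "a = - 16 * r - 2" "a + b + c = 0" "2 * r < b" "b \<le> 7 * r + 1"
    then show thesis
      using \<open>1 \<le> r\<close> by (intro far_a) (auto simp: slot_def potential_def inner_wall_def)
  next
    assume "b = 7 * r + 2" "a + b + c = 1" "0 \<le> c" "c \<le> 9 * r"
    then show thesis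
      using \<open>1 \<le> r\<close> by (intro far_b) (auto simp: slot_def potential_def inner_wall_def)
  next
    assume "c = -1" "a + b + c = 0" "r + 2 \<le> b" "b \<le> 7 * r + 1"
    then show thesis
      using \<open>1 \<le> r\<close> by (intro last) (auto simp: slot_def potential_def inner_wall_def)
  qed
qed

text \<open>The vertex protected in slot \<open>j\<close>: the inverse of \<open>slot\<close>, which shows that no two boundary
  vertices compete for a slot.\<close>

definition site :: "int \<Rightarrow> int \<Rightarrow> int \<times> int \<times> int" where
  "site r j =
     (if j \<le> 26 * r + 2
      then let i = j div 2 in
        if odd j then (if i \<le> r then (1, - i, i) else (r + 1 - i, - r - 1, i))
        else (if i \<le> r then (1 - i, i, - 1) else (1 - i, r + 1, i - r - 1))
      else if j \<le> 27 * r + 3 then let c = j - 13 * r - 2 in (r + 1 - c, - r - 1, c)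
      else if j \<le> 30 * r + 4 then let b = j - 28 * r - 4 in (- 14 * r - 1 - b, b, 14 * r + 2)
      else if j \<le> 35 * r + 5 then let b = j - 28 * r - 4 in (- 16 * r - 2, b, 16 * r + 2 - b)
      else if j \<le> 44 * r + 6 then let c = 44 * r + 6 - j in (- 7 * r - 1 - c, 7 * r + 2, c)
      else let b = 51 * r + 8 - j in (1 - b, b, - 1))"

lemma inj_on_slot:
  assumes "1 \<le> r"
  shows "inj_on (slot r) (barrier r)"
proof (rule inj_on_inverseI)
  fix x assume "x \<in> barrier r"
  moreover obtain a b c where "x = (a, b, c)" by (cases x)
  ultimately show "site r (slot r x) = x"
    using assms by (auto elim!: barrier_cases simp: site_def)
qed

lemma barrier_slot:
  assumes "x \<in> barrier r" "1 \<le> r"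
  shows "1 \<le> slot r x" "slot r x \<le> potential r x + 1" "slot r x \<le> r \<Longrightarrow> slot r x \<le> potential r x"
  using assms by (cases x, auto elim!: barrier_cases)+

text \<open>Each linear form and the norm change by at most \<open>1\<close> along an edge. Only the steps between the two
  branches need an argument. A step to the front branch drops two terms of the maximum, and a step
  to the rear branch goes through the passage beyond the end of the slit, where the
  norm is the largest of the three.\<close>

lemma potential_lipschitz:
  assumes "p \<in> burnt r" "q \<in> verts" "adj p q" "1 \<le> r"
  shows "potential r q \<le> potential r p + 1"
proof -
  obtain a b c where p: "p = (a, b, c)" by (cases p)
  obtain a' b' c' where q: "q = (a', b', c')" by (cases q)
  have step: "\<bar>a - a'\<bar> + \<bar>b - b'\<bar> + \<bar>c - c'\<bar> = 1"
    using assms(3) by (auto simp: p q adj_def)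
  define n n' where "n = \<bar>a\<bar> + \<bar>b\<bar> + \<bar>c\<bar>" and "n' = \<bar>a'\<bar> + \<bar>b'\<bar> + \<bar>c'\<bar>"
  have n: "n' \<le> n + 1" using step unfolding n_def n'_def by linarith
  have n_le: "n \<le> potential r p"
    by (simp add: p potential_def n_def)
  show ?thesis
  proof (cases "b' \<le> r \<or> q \<in> inner_wall r")
    case True
    then have "potential r q = n'" by (simp add: q potential_def n'_def)
    then show ?thesis using n n_le by linarith
  next
    case q_far: False
    then have pot_q: "potential r q =
        max n' (max (b' - a' - c' + 24 * r + 2) (a' + b' - c' + 50 * r + 4))"
      by (simp add: q potential_def n'_def)
    show ?thesis
    proof (cases "b \<le> r")
      case True
      have "(a, b, c) \<in> verts" using assms(1) by (simp add: p burnt_def)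
      from this assms(2,3)[unfolded p q]
      have "a' = a \<and> b = r \<and> b' = r + 1 \<and> c' = c \<and> a = - r - c"
        by (cases rule: adj_cases) (use True q_far in auto)
      then have passage: "a' = a" "b = r" "b' = r + 1" "c' = c" "a = - r - c" by auto
      have "0 \<le> c" using assms(1) by (simp add: p burnt_def)
      then have "12 * r + 1 \<le> c"
        using q_far passage by (simp add: q inner_wall_def)
      then have "potential r q = n'"
        using passage \<open>1 \<le> r\<close> unfolding pot_q n'_def by simp
      then show ?thesis using n n_le by linarith
    next
      case False
      then have "potential r p =
          max n (max (b - a - c + 24 * r + 2) (a + b - c + 50 * r + 4))"
        using assms(1) by (simp add: p potential_def n_def burnt_def)
      then show ?thesis using n step unfolding pot_q by linarith
    qed
  qed
qed

lemma finite_burnt: "finite (burnt r)"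
  by (rule finite_subset[of _ "{- (16 * r + 1)..0} \<times> {- r..7 * r + 1} \<times> {0..14 * r + 1}"])
     (auto simp: burnt_def)

lemma finite_barrier: "finite (barrier r)"
  by (rule finite_subset[of _ "{- (16 * r + 2)..1} \<times> {- r - 1..7 * r + 2} \<times> {- 1..14 * r + 2}"])
     (auto simp: barrier_def burnt_def adj_def)

section \<open>Integer coordinates on the hexagonal grid\<close>

definition pos :: "int \<times> int \<times> int \<Rightarrow> complex" where
  "pos = (\<lambda>(a, b, c).
     of_int a + of_int b * cis (2 * pi / 3) + of_int c * cis (4 * pi / 3))"

lemma cis_third: "cis (pi / 3) = Complex (1 / 2) (sqrt 3 / 2)"
  by (simp add: cis.code cos_60 sin_60)

lemma pos_eq: "pos (a, b, c) = Complex ((2 * a - b - c) / 2) (sqrt 3 / 2 * (b - c))"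
proof -
  have "cis (2 * pi / 3) = Complex (- 1 / 2) (sqrt 3 / 2)"
    by (simp add: cis.code cos_120 sin_120)
  moreover have "4 * pi / 3 = pi / 3 + pi" by simp
  then have "cis (4 * pi / 3) = Complex (- 1 / 2) (- sqrt 3 / 2)"
    by (simp only: cis.code cos_periodic_pi sin_periodic_pi) (simp add: cos_60 sin_60)
  ultimately show ?thesis
    by (simp add: pos_def complex_eq_iff field_simps)
qed

lemma pos_eq_0_iff: "pos (a, b, c) = 0 \<longleftrightarrow> a = b \<and> b = c"
  by (auto simp: pos_eq complex_eq_iff)

lemma pos_diff: "pos (a, b, c) - pos (a', b', c') = pos (a - a', b - b', c - c')"
  by (simp add: pos_eq complex_eq_iff algebra_simps diff_divide_distrib add_divide_distrib)

lemma pos_add: "pos (a, b, c) + pos (a', b', c') = pos (a + a', b + b', c + c')"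
  by (simp add: pos_eq complex_eq_iff algebra_simps diff_divide_distrib add_divide_distrib)

lemma pos_eq_iff: "pos (a, b, c) = pos (a', b', c') \<longleftrightarrow> a - a' = b - b' \<and> b - b' = c - c'"
  using pos_diff[of a b c a' b' c'] pos_eq_0_iff[of "a - a'" "b - b'" "c - c'"] by auto

text \<open>Rotation by \<open>pi / 3\<close>; the minus signs come from \<open>cis (4 * pi / 3) = - cis (pi / 3)\<close>.\<close>

definition rot :: "int \<times> int \<times> int \<Rightarrow> int \<times> int \<times> int" where
  "rot = (\<lambda>(a, b, c). (- b, - c, - a))"

lemma pos_rot: "pos (rot x) = cis (pi / 3) * pos x"
  by (cases x) (simp add: rot_def pos_eq cis_third complex_eq_iff field_simps)

lemma cis_sixth: "cis (real k * pi / 3) = pos ((rot ^^ k) (1, 0, 0))"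
proof (induction k)
  case 0
  then show ?case by (simp add: pos_def)
next
  case (Suc k)
  have "cis (real (Suc k) * pi / 3) = cis (pi / 3) * cis (real k * pi / 3)"
    by (simp add: cis_mult field_simps)
  then show ?case using Suc by (simp add: pos_rot)
qed

abbreviation units :: "(int \<times> int \<times> int) set" where
  "units \<equiv> {(1, 0, 0), (0, 1, 0), (0, 0, 1), (- 1, 0, 0), (0, - 1, 0), (0, 0, - 1)}"

lemma rot_units:
  "(rot ^^ k) (1, 0, 0) \<in> units"
  by (induction k) (auto simp: rot_def)

lemma hex_centres_pos: "hex_centres = {pos (a, b, c) | a b c. a + b + c = 0}"
proof -
  have "(of_int m + of_int n * cis (pi / 3)) * (1 + cis (pi / 3)) = pos (m, n, - m - n)" for m n
    by (simp add: cis_third pos_eq complex_eq_iff field_simps)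
  moreover have "a + b + c = 0 \<longleftrightarrow> c = - a - b" for a b c :: int by auto
  ultimately show ?thesis by (auto simp: hex_centres_def)
qed

lemma pos_centreI: "a + b + c = 0 \<Longrightarrow> pos (a, b, c) \<in> hex_centres"
  unfolding hex_centres_pos by blast

lemma hex_vertices_pos:
  "hex_vertices = {pos (a, b, c) | a b c. a + b + c = 1 \<or> a + b + c = -1}"
proof (intro equalityI subsetI)
  fix v assume "v \<in> hex_vertices"
  then obtain a b c k where s: "a + b + c = 0"
    and v: "v = pos (a, b, c) + pos ((rot ^^ k) (1, 0, 0))"
    by (auto simp: hex_vertices_def hex_corner_def hex_centres_pos cis_sixth)
  obtain a' b' c' where u: "(rot ^^ k) (1, 0, 0) = (a', b', c')"
    by (cases "(rot ^^ k) (1, 0, 0)")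
  have "a' + b' + c' = 1 \<or> a' + b' + c' = -1"
    using rot_units[of k] unfolding u by auto
  then have "(a + a') + (b + b') + (c + c') = 1 \<or> (a + a') + (b + b') + (c + c') = -1"
    using s by linarith
  then show "v \<in> {pos (a, b, c) | a b c. a + b + c = 1 \<or> a + b + c = -1}"
    unfolding v u pos_add by blast
next
  fix v assume "v \<in> {pos (a, b, c) | a b c. a + b + c = 1 \<or> a + b + c = -1}"
  then obtain a b c where v: "v = pos (a, b, c)" and s: "a + b + c = 1 \<or> a + b + c = -1" by auto
  have rot3: "(rot ^^ 3) (1, 0, 0) = (- 1, 0, 0)" by (simp add: rot_def numeral_eq_Suc)
  from s show "v \<in> hex_vertices"
  proof
    assume "a + b + c = 1"
    then have "pos (a - 1, b, c) \<in> hex_centres" by (intro pos_centreI) simp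
    moreover have "v = hex_corner (pos (a - 1, b, c)) 0"
      unfolding hex_corner_def cis_sixth v by (simp add: pos_add)
    ultimately show ?thesis unfolding hex_vertices_def by blast
  next
    assume "a + b + c = -1"
    then have "pos (a + 1, b, c) \<in> hex_centres" by (intro pos_centreI) simp
    moreover have "v = hex_corner (pos (a + 1, b, c)) 3"
      unfolding hex_corner_def cis_sixth v rot3 by (simp add: pos_add)
    ultimately show ?thesis unfolding hex_vertices_def by blast
  qed
qed

lemma pos_vertexI: "a + b + c = 1 \<or> a + b + c = -1 \<Longrightarrow> pos (a, b, c) \<in> hex_vertices"
  unfolding hex_vertices_pos by blast

text \<open>Consecutive corners of a regular hexagon differ by a vector of the same length as its radius,
  turned by a further \<open>pi / 3\<close>.\<close>

lemma hex_edge_diff: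
  assumes "{u, v} \<in> hex_edges"
  obtains x where "v - u = pos x"
    "x \<in> units"
proof -
  from assms obtain c k where edge: "{u, v} = {hex_corner c k, hex_corner c (Suc k)}"
    by (auto simp: hex_edges_def)
  obtain x y z where xyz: "(rot ^^ Suc (Suc k)) (1, 0, 0) = (x, y, z)"
    by (metis prod_cases3)
  have units: "(x, y, z) \<in> units"
    using rot_units[of "Suc (Suc k)"] unfolding xyz .
  have diff: "hex_corner c (Suc k) - hex_corner c k = pos (x, y, z)"
  proof -
    obtain a' b' c' where "(rot ^^ k) (1, 0, 0) = (a', b', c')"
      by (metis prod_cases3)
    then show ?thesis
      unfolding hex_corner_def cis_sixth using xyz
      by (auto simp: rot_def pos_diff pos_eq_iff)
  qed
  from edge consider "v - u = pos (x, y, z)" | "u - v = pos (x, y, z)"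
    using diff by (auto simp: doubleton_eq_iff)
  then show thesis
  proof cases
    case 1
    then show thesis using units by (rule that)
  next
    case 2
    then have "v - u = - pos (x, y, z)" by (metis minus_diff_eq)
    also have "\<dots> = pos (- x, - y, - z)"
      by (simp add: pos_eq complex_eq_iff field_simps)
    finally show thesis by (rule that) (use units in auto)
  qed
qed

text \<open>The grid has two classes of vertices, with sums \<open>1\<close> and \<open>-1\<close> modulo \<open>3\<close>, and the three edges at a
  vertex point in opposite directions for the two classes. Up to the sign \<open>\<epsilon>\<close>, the grid thus
  looks the same from every vertex.\<close>

lemma hex_coordinates:
  assumes "f \<in> hex_vertices"
  obtains \<phi> where "\<phi> (0, 0, 0) = f" "bij_betw \<phi> verts hex_vertices"
    "\<And>p q. p \<in> verts \<Longrightarrow> q \<in> verts \<Longrightarrow> {\<phi> p, \<phi> q} \<in> hex_edges \<Longrightarrow> adj p q"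
proof -
  from assms obtain a0 b0 c0 where f: "f = pos (a0, b0, c0)"
    and s: "a0 + b0 + c0 = 1 \<or> a0 + b0 + c0 = -1"
    by (auto simp: hex_vertices_pos)
  define \<epsilon> where "\<epsilon> = a0 + b0 + c0"
  have \<epsilon>: "\<epsilon> = 1 \<or> \<epsilon> = -1" using s by (simp add: \<epsilon>_def)
  define \<phi> where "\<phi> = (\<lambda>(a, b, c). pos (a0 + \<epsilon> * a, b0 + \<epsilon> * b, c0 + \<epsilon> * c))"
  have "\<phi> (0, 0, 0) = f" by (simp add: \<phi>_def f)
  moreover have "inj_on \<phi> verts"
    using \<epsilon> by (auto simp: inj_on_def \<phi>_def pos_eq_iff verts_def)
  moreover have "\<phi> ` verts = hex_vertices"
  proof (intro equalityI subsetI)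
    fix v assume "v \<in> \<phi> ` verts"
    then obtain a b c where abc: "a + b + c = 0 \<or> a + b + c = 1" and v: "v = \<phi> (a, b, c)"
      by (auto simp: verts_def)
    from abc show "v \<in> hex_vertices"
    proof
      assume "a + b + c = 0"
      then have "(a0 + \<epsilon> * a) + (b0 + \<epsilon> * b) + (c0 + \<epsilon> * c) = \<epsilon>"
        using \<epsilon> \<epsilon>_def by auto
      then show ?thesis using \<epsilon> unfolding v \<phi>_def prod.case by (intro pos_vertexI) linarith
    next
      assume "a + b + c = 1"
      then have "(a0 + \<epsilon> * a - \<epsilon>) + (b0 + \<epsilon> * b - \<epsilon>) + (c0 + \<epsilon> * c - \<epsilon>) = - \<epsilon>"
        using \<epsilon> \<epsilon>_def by auto
      (* The sum is now 2 * \<epsilon>, which has to be brought back to 1 or -1 by a shift along (1, 1, 1). *)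
      moreover have "v = pos (a0 + \<epsilon> * a - \<epsilon>, b0 + \<epsilon> * b - \<epsilon>, c0 + \<epsilon> * c - \<epsilon>)"
        by (simp add: v \<phi>_def pos_eq_iff)
      ultimately show ?thesis using \<epsilon> by (simp only:) (intro pos_vertexI, linarith)
    qed
  next
    fix v assume "v \<in> hex_vertices"
    then obtain a b c where v: "v = pos (a, b, c)" and "a + b + c = 1 \<or> a + b + c = -1"
      by (auto simp: hex_vertices_pos)
    then consider "a + b + c = \<epsilon>" | "a + b + c = - \<epsilon>" using \<epsilon> by auto
    then show "v \<in> \<phi> ` verts"
    proof cases
      case 1
      then have "(\<epsilon> * (a - a0), \<epsilon> * (b - b0), \<epsilon> * (c - c0)) \<in> verts"
        using \<epsilon> \<epsilon>_def by (auto simp: verts_def)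
      moreover have "v = \<phi> (\<epsilon> * (a - a0), \<epsilon> * (b - b0), \<epsilon> * (c - c0))"
        using \<epsilon> by (auto simp: v \<phi>_def)
      ultimately show ?thesis by blast
    next
      case 2
      then have "(\<epsilon> * (a + \<epsilon> - a0), \<epsilon> * (b + \<epsilon> - b0), \<epsilon> * (c + \<epsilon> - c0)) \<in> verts"
        using \<epsilon> \<epsilon>_def by (auto simp: verts_def)
      moreover have "v = \<phi> (\<epsilon> * (a + \<epsilon> - a0), \<epsilon> * (b + \<epsilon> - b0), \<epsilon> * (c + \<epsilon> - c0))"
        using \<epsilon> by (auto simp: v \<phi>_def pos_eq_iff)
      ultimately show ?thesis by blast
    qed
  qed
  moreover have "adj p q" if pq: "p \<in> verts" "q \<in> verts" and "{\<phi> p, \<phi> q} \<in> hex_edges" for p q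
  proof -
    obtain a b c where p: "p = (a, b, c)" by (cases p)
    obtain a' b' c' where q: "q = (a', b', c')" by (cases q)
    from hex_edge_diff[OF that(3)] obtain x y z where xyz: "\<phi> q - \<phi> p = pos (x, y, z)"
      "(x, y, z) \<in> units"
      by (metis prod_cases3)
    define A B C where "A = \<epsilon> * (a' - a)" and "B = \<epsilon> * (b' - b)" and "C = \<epsilon> * (c' - c)"
    have "A - x = B - y" "B - y = C - z"
      using xyz(1) by (simp_all add: A_def B_def C_def p q \<phi>_def pos_diff pos_eq_iff algebra_simps)
    moreover have "\<bar>A + B + C\<bar> \<le> 1"
      using pq \<epsilon> by (auto simp: A_def B_def C_def p q verts_def)
    moreover have "\<bar>x + y + z\<bar> = 1" using xyz(2) by auto
    ultimately have "A = x" "B = y" "C = z" by linarith+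
    then have "(A, B, C) \<in> units"
      using xyz(2) by simp
    moreover have "\<bar>a - a'\<bar> = \<bar>A\<bar>" "\<bar>b - b'\<bar> = \<bar>B\<bar>" "\<bar>c - c'\<bar> = \<bar>C\<bar>"
      using \<epsilon> by (auto simp: A_def B_def C_def)
    ultimately show ?thesis
      unfolding p q adj_def prod.case by (auto simp del: abs_eq_iff)
  qed
  ultimately show thesis using that by (simp add: bij_betw_def)
qed

section \<open>Containing the fire\<close>

theorem theorem1p2:
  fixes f :: complex and \<tau> :: nat
  assumes "f \<in> hex_vertices" and "\<tau> \<ge> 1"
  shows "\<exists>D F P. firefighter_process hex_vertices hex_edges {f} D F P \<and>
           (\<forall>t\<ge>1. t \<noteq> \<tau> \<longrightarrow> finite (D (2 * t)) \<and> card (D (2 * t)) \<le> 1) \<and>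
           finite (D (2 * \<tau>)) \<and> card (D (2 * \<tau>)) \<le> 2 \<and>
           fire_contained hex_vertices hex_edges F P"
proof -
  obtain \<phi> where \<phi>: "\<phi> (0, 0, 0) = f" "bij_betw \<phi> verts hex_vertices"
    and edge: "\<And>p q. p \<in> verts \<Longrightarrow> q \<in> verts \<Longrightarrow> {\<phi> p, \<phi> q} \<in> hex_edges \<Longrightarrow> adj p q"
    using hex_coordinates[OF assms(1)] by metis
  (* The wedge accounts for the first 2 * r + 1 slots, so the extra firefighter comes before the walls
     become parallel. *)
  define r where "r = int \<tau>"
  have r: "1 \<le> r" using assms(2) by (simp add: r_def)
  define \<psi> where "\<psi> = inv_into verts \<phi>"
  have \<psi>: "\<psi> (\<phi> p) = p" if "p \<in> verts" for p
    using \<phi>(2) that by (simp add: \<psi>_def bij_betw_def)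
  have V: "hex_vertices = \<phi> ` verts" using \<phi>(2) by (simp add: bij_betw_def)
  have inj: "inj_on \<phi> verts" using \<phi>(2) by (simp add: bij_betw_def)
  have sub: "burnt r \<subseteq> verts" "barrier r \<subseteq> verts"
    by (auto simp: burnt_def barrier_def)
  have nbr: "\<exists>p q. p \<in> burnt r \<and> q \<in> verts \<and> u = \<phi> p \<and> v = \<phi> q \<and> adj p q"
    if "u \<in> \<phi> ` burnt r" "v \<in> hex_vertices" "{u, v} \<in> hex_edges" for u v
    using that edge sub unfolding V by blast
  show ?thesis
  proof (rule containment_by_potential[where K = "\<phi> ` burnt r" and B = "\<phi> ` barrier r"
        and d = "potential r \<circ> \<psi>" and slot = "slot r \<circ> \<psi>"])
    have "(0, 0, 0) \<in> burnt r" using r by (simp add: burnt_def verts_def inner_wall_def)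
    then show "f \<in> \<phi> ` burnt r" using \<phi>(1) by force
    have "(0, 0, 0) \<in> verts" by (simp add: verts_def)
    then show "(potential r \<circ> \<psi>) f = 0"
      using r \<phi>(1) \<psi>[of "(0, 0, 0)"] by (simp add: potential_def)
    show "\<phi> ` burnt r \<subseteq> hex_vertices" "\<phi> ` barrier r \<subseteq> hex_vertices"
      using sub V by auto
    show "finite (\<phi> ` burnt r)" "finite (\<phi> ` barrier r)"
      by (simp_all add: finite_burnt finite_barrier)
    show "\<phi> ` burnt r \<inter> \<phi> ` barrier r = {}"
      using inj_on_image_Int[OF inj sub] by (auto simp: barrier_def)
    show "v \<in> \<phi> ` burnt r \<union> \<phi> ` barrier r"
      if "u \<in> \<phi> ` burnt r" "v \<in> hex_vertices" "{u, v} \<in> hex_edges" for u v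
      using nbr[OF that] by (auto simp: barrier_def)
    show "(potential r \<circ> \<psi>) v \<le> (potential r \<circ> \<psi>) u + 1"
      if "u \<in> \<phi> ` burnt r" "v \<in> hex_vertices" "{u, v} \<in> hex_edges" for u v
      using nbr[OF that] potential_lipschitz r sub \<psi> by (auto simp: subset_iff)
    show "inj_on (slot r \<circ> \<psi>) (\<phi> ` barrier r)"
      using inj_on_slot[OF r] \<psi> sub by (auto simp: inj_on_def subset_iff)
    show "1 \<le> (slot r \<circ> \<psi>) b" "(slot r \<circ> \<psi>) b \<le> (potential r \<circ> \<psi>) b + 1"
      if "b \<in> \<phi> ` barrier r" for b
      using that barrier_slot(1,2) r \<psi> sub by auto
    show "(slot r \<circ> \<psi>) b \<le> (potential r \<circ> \<psi>) b"
      if "b \<in> \<phi> ` barrier r" "(slot r \<circ> \<psi>) b \<le> int \<tau>" for b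
      using that barrier_slot(3) r \<psi> sub unfolding r_def by auto
  qed (rule assms(2))
qed

end
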